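(* Let $\lambda>0$, let $\hat\beta$ be the square-root Lasso, i.e. a minimizer over $\beta\in\mathbb{R}^p$ of $\|Y-X\beta\|_n+\lambda\|\beta\|_1$, where $Y=X\beta^0+\epsilon$, and let $\hat\epsilon:=Y-X\hat\beta$. Then $$\|\hat\epsilon\|_n\le\|\epsilon\|_n+\lambda\|\beta^0\|_1 .$$ Moreover, if for a constant $\lambda_0>0$ satisfying $\lambda_0\|\epsilon\|_n\ge\|\epsilon^TX\|_\infty/n$ the tuning parameter $\lambda$ has $\lambda(1-\eta^2)>2\lambda_0$ for some $\eta>0$ and $$\|\beta^0\|_1\le\frac{\|\epsilon\|_n}{4\lambda_0}\Big(1-\eta^2-\frac{2\lambda_0}{\lambda}\Big),$$ then $\|\hat\epsilon\|_n^2\ge\eta^2\|\epsilon\|_n^2$.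
   Context: $X$ is a fixed $n\times p$ real matrix of rank $n$, $Y\in\mathbb{R}^n$, $f^0=\mathbb{E}Y$, $\beta^0\in\mathbb{R}^p$ is a solution of $X\beta^0=f^0$, and $\epsilon:=Y-f^0$, so $Y=X\beta^0+\epsilon$ (the result is deterministic: it holds for any realization of $\epsilon$). For $v\in\mathbb{R}^n$, $\|v\|_n:=\sqrt{v^Tv/n}$; $\|\cdot\|_1,\|\cdot\|_\infty$ are the $\ell_1$- and $\ell_\infty$-norms of vectors. *)

theory Defs
  imports "HOL-Analysis.Analysis"
begin

definition norm_n :: "real ^ 'n \<Rightarrow> real" where
  "norm_n v = sqrt ((v \<bullet> v) / real CARD('n))"

definition norm_l1 :: "real ^ 'p \<Rightarrow> real" where
  "norm_l1 b = (\<Sum>j\<in>UNIV. \<bar>b $ j\<bar>)"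

definition sqrt_lasso_objective ::
    "real ^ 'p ^ 'n \<Rightarrow> real ^ 'n \<Rightarrow> real \<Rightarrow> real ^ 'p \<Rightarrow> real" where
  "sqrt_lasso_objective X Y lam b = norm_n (Y - X *v b) + lam * norm_l1 b"

(* A relation, not a function: minimizers need not be unique. *)
definition is_sqrt_lasso ::
    "real ^ 'p ^ 'n \<Rightarrow> real ^ 'n \<Rightarrow> real \<Rightarrow> real ^ 'p \<Rightarrow> bool" where
  "is_sqrt_lasso X Y lam b \<longleftrightarrow> is_arg_min (sqrt_lasso_objective X Y lam) (\<lambda>_. True) b"

end

theory Submission
  imports Defs
begin

text \<open>
  Comparing the objective at the minimizer with its value at \<open>beta0\<close> gives the first bound, and also
  bounds the \<open>l1\<close>-norm of the minimizer by that of \<open>beta0\<close> plus \<open>norm_n eps / lam\<close>.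
  For the lower bound, expand the square of \<open>eps_hat = eps - X (beta_hat - beta0)\<close>, discard
  the nonnegative quadratic term, and control the cross term by the duality of the \<open>l1\<close>- and
  \<open>l\<infinity>\<close>-norms and the bound on the noise.
\<close>

lemma norm_n_nonneg: "0 \<le> norm_n v"
  by (simp add: norm_n_def)

lemma norm_n_power2: "(norm_n (v :: real ^ 'n))\<^sup>2 = (v \<bullet> v) / real CARD('n)"
  by (simp add: norm_n_def)

lemma norm_l1_nonneg: "0 \<le> norm_l1 b"
  by (simp add: norm_l1_def sum_nonneg)

lemma norm_l1_diff_le: "norm_l1 (a - b) \<le> norm_l1 a + norm_l1 b"
  by (simp add: norm_l1_def flip: sum.distrib) (intro sum_mono abs_triangle_ineq4)

lemma inner_le_infnorm_norm_l1: "x \<bullet> y \<le> infnorm x * norm_l1 y"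
proof -
  have "x $ j * y $ j \<le> infnorm x * \<bar>y $ j\<bar>" for j
  proof -
    have "x $ j * y $ j \<le> \<bar>x $ j\<bar> * \<bar>y $ j\<bar>"
      by (metis abs_ge_self abs_mult)
    also have "\<dots> \<le> infnorm x * \<bar>y $ j\<bar>"
      by (intro mult_right_mono component_le_infnorm_cart) simp
    finally show ?thesis .
  qed
  then show ?thesis
    by (simp add: inner_vec_def norm_l1_def sum_distrib_left sum_mono)
qed

lemma norm_n_diff_power2_ge:
  fixes u v :: "real ^ 'n"
  shows "(norm_n (u - v))\<^sup>2 \<ge> (norm_n u)\<^sup>2 - 2 * (u \<bullet> v) / real CARD('n)"
proof -
  have "u \<bullet> u - 2 * (u \<bullet> v) \<le> (u - v) \<bullet> (u - v)"
    using inner_ge_zero[of v] by (simp add: inner_diff inner_commute)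
  then have "(u \<bullet> u - 2 * (u \<bullet> v)) / real CARD('n) \<le> (u - v) \<bullet> (u - v) / real CARD('n)"
    by (rule divide_right_mono) simp
  then show ?thesis
    by (simp add: norm_n_power2 diff_divide_distrib)
qed

lemma is_sqrt_lasso_le:
  assumes "is_sqrt_lasso X Y lam b"
  shows "norm_n (Y - X *v b) + lam * norm_l1 b \<le> norm_n (Y - X *v b') + lam * norm_l1 b'"
  using assms
  by (simp add: is_sqrt_lasso_def is_arg_min_def sqrt_lasso_objective_def not_less)

theorem lemma1p4p1:
  fixes X :: "real ^ 'p ^ 'n"
    and Y f0 eps eps_hat :: "real ^ 'n"
    and beta0 beta_hat :: "real ^ 'p"
    and lam :: real
  assumes rank_X: "rank X = CARD('n)"
    and beta0: "X *v beta0 = f0"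
    and eps: "eps = Y - f0"
    and lam_pos: "lam > 0"
    and beta_hat: "is_sqrt_lasso X Y lam beta_hat"
    and eps_hat: "eps_hat = Y - X *v beta_hat"
  shows "norm_n eps_hat \<le> norm_n eps + lam * norm_l1 beta0 \<and>
    (\<forall>lam0 eta :: real.
      lam0 > 0 \<longrightarrow>
      lam0 * norm_n eps \<ge> infnorm (eps v* X) / real CARD('n) \<longrightarrow>
      eta > 0 \<longrightarrow>
      lam * (1 - eta\<^sup>2) > 2 * lam0 \<longrightarrow>
      norm_l1 beta0 \<le> norm_n eps / (4 * lam0) * (1 - eta\<^sup>2 - 2 * lam0 / lam) \<longrightarrow>
      (norm_n eps_hat)\<^sup>2 \<ge> eta\<^sup>2 * (norm_n eps)\<^sup>2)"
proof (intro conjI allI impI)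
  have basic: "norm_n eps_hat + lam * norm_l1 beta_hat \<le> norm_n eps + lam * norm_l1 beta0"
    using is_sqrt_lasso_le[OF beta_hat, of beta0] by (simp add: beta0 eps eps_hat)
  have "0 \<le> lam * norm_l1 beta_hat"
    using lam_pos norm_l1_nonneg[of beta_hat] by simp
  with basic show "norm_n eps_hat \<le> norm_n eps + lam * norm_l1 beta0"
    by linarith

  fix lam0 eta :: real
  assume lam0_pos: "lam0 > 0"
    and noise: "lam0 * norm_n eps \<ge> infnorm (eps v* X) / real CARD('n)"
    and small: "norm_l1 beta0 \<le> norm_n eps / (4 * lam0) * (1 - eta\<^sup>2 - 2 * lam0 / lam)"
  let ?E = "norm_n eps" and ?d = "beta_hat - beta0"
  have "lam * norm_l1 beta_hat \<le> lam * (norm_l1 beta0 + ?E / lam)"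
    using basic norm_n_nonneg[of eps_hat] lam_pos by (simp add: distrib_left)
  then have "norm_l1 beta_hat \<le> norm_l1 beta0 + ?E / lam"
    using lam_pos by simp
  then have l1: "norm_l1 ?d \<le> 2 * norm_l1 beta0 + ?E / lam"
    using norm_l1_diff_le[of beta_hat beta0] by linarith
  have "eps \<bullet> (X *v ?d) / real CARD('n) \<le> infnorm (eps v* X) * norm_l1 ?d / real CARD('n)"
    using inner_le_infnorm_norm_l1[of "eps v* X" ?d]
    by (intro divide_right_mono) (simp_all add: dot_lmul_matrix)
  also have "\<dots> \<le> lam0 * ?E * norm_l1 ?d"
    using mult_right_mono[OF noise norm_l1_nonneg[of ?d]] by simp
  also have "\<dots> \<le> lam0 * ?E * (2 * norm_l1 beta0 + ?E / lam)"
    using l1 lam0_pos norm_n_nonneg[of eps] by (intro mult_left_mono) auto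
  finally have cross: "eps \<bullet> (X *v ?d) / real CARD('n)
      \<le> lam0 * ?E * (2 * norm_l1 beta0 + ?E / lam)" .
  have "4 * lam0 * ?E * norm_l1 beta0
      \<le> 4 * lam0 * ?E * (?E / (4 * lam0) * (1 - eta\<^sup>2 - 2 * lam0 / lam))"
    using small lam0_pos norm_n_nonneg[of eps] by (intro mult_left_mono) auto
  also have "\<dots> = ?E\<^sup>2 * (1 - eta\<^sup>2 - 2 * lam0 / lam)"
    using lam0_pos by (simp add: power2_eq_square)
  finally have "eta\<^sup>2 * ?E\<^sup>2 \<le> ?E\<^sup>2 - 2 * (lam0 * ?E * (2 * norm_l1 beta0 + ?E / lam))"
    by (simp add: algebra_simps power2_eq_square)
  also have "\<dots> \<le> ?E\<^sup>2 - 2 * (eps \<bullet> (X *v ?d)) / real CARD('n)"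
    using cross by simp
  also have "\<dots> \<le> (norm_n (eps - X *v ?d))\<^sup>2"
    by (rule norm_n_diff_power2_ge)
  also have "eps - X *v ?d = eps_hat"
    by (simp add: eps eps_hat beta0 matrix_vector_mult_diff_distrib)
  finally show "(norm_n eps_hat)\<^sup>2 \<ge> eta\<^sup>2 * ?E\<^sup>2" .
qed

end
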